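(* Let $k,n,q$ be positive integers and fix page functions $g_1,\dots,g_n:\Omega_{k,q}\to[q]$ on $B_{k,n}$. These page functions can be completed by spine functions to a winning $q$-color strategy on $B_{k,n}$ if and only if they guard every non-coverable configuration $P\subseteq\Omega_{k,q}$.
   Context: The book graph $B_{k,n}=K_k\vee\overline{K_n}$ has $k$ mutually adjacent vertices (spines) and $n$ pairwise nonadjacent vertices (pages), every page adjacent to every spine. Let $[q]=\{0,\dots,q-1\}$ and $\Omega_{k,q}=\{\boldsymbol{x}\in[q]^k: x_i\ne x_j \text{ whenever } i\neq j\}$. A proper $q$-coloring of $B_{k,n}$ is a pair $(\boldsymbol{x},\boldsymbol{z})\in\Omega_{k,q}\times[q]^n$ (spine colors, page colors) with $z_j\notin\{x_1,\dots,x_k\}$ for all $j$. In the proper hat-guessing game with $q$ colors on $B_{k,n}$, page $j$ uses a guess function $g_j:\Omega_{k,q}\to[q]$ of the spine tuple, and spine $i$ uses a $[q]$-valued guess function of $(\boldsymbol{x}_{-i},\boldsymbol{z})$, where $\boldsymbol{x}_{-i}$ is $\boldsymbol{x}$ with coordinate $i$ deleted. A strategy is winning if for every proper $q$-coloring at least one vertex's guess equals its own color. A configuration is a subset $P\subseteq\Omega_{k,q}$. With $\pi_i(\boldsymbol{x})=\boldsymbol{x}_{-i}$, a set $A\subseteq\Omega_{k,q}$ is $i$-saturated if $\pi_i$ restricted to $A$ is injective; $P$ is coverable if it has a partition $P=P_1\,\dot\cup\cdots\dot\cup\,P_k$ (parts may be empty) with $P_i$ being $i$-saturated for every $i$. Let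 $\mathrm{supp}(P)=\bigcup_{\boldsymbol{x}\in P}\{x_1,\dots,x_k\}$ and $g_j(P)=\{g_j(\boldsymbol{x}):\boldsymbol{x}\in P\}$. Page $j$ guards $P$ if $[q]\setminus\mathrm{supp}(P)\subseteq g_j(P)$. The family of pages guards $P$ if at least one page guards it. *)

theory Defs
  imports "HOL-Library.FuncSet" "HOL-Library.Disjoint_Sets"
begin

text \<open>
  Colors are the naturals below \<open>q\<close>. A tuple is a list, and spines and pages are indexed from 0:
  spine \<open>i < k\<close> has color \<open>x ! i\<close>, page \<open>j < n\<close> has color \<open>z ! j\<close>.
\<close>

definition tuples :: "nat \<Rightarrow> nat \<Rightarrow> nat list set" where
  "tuples m q = {x. length x = m \<and> set x \<subseteq> {..<q}}"

definition Omega :: "nat \<Rightarrow> nat \<Rightarrow> nat list set" where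
  "Omega k q = {x \<in> tuples k q. distinct x}"

definition proper_colorings :: "nat \<Rightarrow> nat \<Rightarrow> nat \<Rightarrow> (nat list \<times> nat list) set" where
  "proper_colorings k n q = {(x, z). x \<in> Omega k q \<and> z \<in> tuples n q \<and> (\<forall>j<n. z ! j \<notin> set x)}"

definition delete_coord :: "nat \<Rightarrow> 'a list \<Rightarrow> 'a list" where
  "delete_coord i x = take i x @ drop (Suc i) x"

definition page_functions :: "nat \<Rightarrow> nat \<Rightarrow> nat \<Rightarrow> (nat \<Rightarrow> nat list \<Rightarrow> nat) \<Rightarrow> bool" where
  "page_functions k n q g \<longleftrightarrow> (\<forall>j<n. g j \<in> Omega k q \<rightarrow> {..<q})"

text \<open>
  For \<open>x \<in> Omega k q\<close> and \<open>i < k\<close>, the tuple \<open>delete_coord i x\<close> lies in \<open>Omega (k - 1) q\<close>, so the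
  domain below contains every view of a spine.
\<close>

definition spine_functions ::
    "nat \<Rightarrow> nat \<Rightarrow> nat \<Rightarrow> (nat \<Rightarrow> nat list \<times> nat list \<Rightarrow> nat) \<Rightarrow> bool" where
  "spine_functions k n q h \<longleftrightarrow> (\<forall>i<k. h i \<in> Omega (k - 1) q \<times> tuples n q \<rightarrow> {..<q})"

definition winning ::
    "nat \<Rightarrow> nat \<Rightarrow> nat \<Rightarrow> (nat \<Rightarrow> nat list \<Rightarrow> nat) \<Rightarrow> (nat \<Rightarrow> nat list \<times> nat list \<Rightarrow> nat) \<Rightarrow> bool" where
  "winning k n q g h \<longleftrightarrow>
     (\<forall>(x, z) \<in> proper_colorings k n q.
        (\<exists>j<n. g j x = z ! j) \<or> (\<exists>i<k. h i (delete_coord i x, z) = x ! i))"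

definition saturated :: "nat \<Rightarrow> nat list set \<Rightarrow> bool" where
  "saturated i A \<longleftrightarrow> inj_on (delete_coord i) A"

definition coverable :: "nat \<Rightarrow> nat list set \<Rightarrow> bool" where
  "coverable k P \<longleftrightarrow>
     (\<exists>Q. P = (\<Union>i<k. Q i) \<and> disjoint_family_on Q {..<k} \<and> (\<forall>i<k. saturated i (Q i)))"

definition supp :: "nat list set \<Rightarrow> nat set" where
  "supp P = (\<Union>x\<in>P. set x)"

definition page_guards :: "nat \<Rightarrow> (nat list \<Rightarrow> nat) \<Rightarrow> nat list set \<Rightarrow> bool" where
  "page_guards q f P \<longleftrightarrow> {..<q} - supp P \<subseteq> f ` P"

definition pages_guard :: "nat \<Rightarrow> nat \<Rightarrow> (nat \<Rightarrow> nat list \<Rightarrow> nat) \<Rightarrow> nat list set \<Rightarrow> bool" where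
  "pages_guard n q g P \<longleftrightarrow> (\<exists>j<n. page_guards q (g j) P)"

end

theory Submission
  imports Defs
begin

text \<open>
  Once the page colors \<open>z\<close> are fixed, the spines must handle exactly the set of spine tuples that
  are compatible with \<open>z\<close> and on which all pages guess wrongly. The views of different \<open>z\<close> are
  disjoint, so the sets for different \<open>z\<close> can be treated independently, and spine \<open>i\<close> can be correct
  on precisely the \<open>i\<close>-saturated sets. Hence the pages can be completed iff all these sets are
  coverable, and every configuration that no page guards is contained in one of them.
\<close>

definition missed :: "nat \<Rightarrow> nat \<Rightarrow> nat \<Rightarrow> (nat \<Rightarrow> nat list \<Rightarrow> nat) \<Rightarrow> nat list \<Rightarrow> nat list set" where
  "missed k n q g z = {x \<in> Omega k q. \<forall>j<n. z ! j \<notin> set x \<and> g j x \<noteq> z ! j}"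

lemma nth_tuples_less: "x \<in> tuples m q \<Longrightarrow> i < m \<Longrightarrow> x ! i < q"
  unfolding tuples_def using nth_mem by blast

lemma delete_coord_nth_inject:
  assumes "length x = length y" and "i < length x"
    and "delete_coord i x = delete_coord i y" and "x ! i = y ! i"
  shows "x = y"
proof -
  have "take i x = take i y" "drop (Suc i) x = drop (Suc i) y"
    using assms(1,3) by (simp_all add: delete_coord_def)
  then show ?thesis
    using assms(1,2,4) id_take_nth_drop[of i x] id_take_nth_drop[of i y] by simp
qed

text \<open>A guess \<open>f\<close> sees only the shortened tuple. Two tuples of \<open>A\<close>
  with the same view receive the same guess, so they also agree at coordinate \<open>i\<close> and
  are equal.\<close>

lemma saturatedI:
  assumes "A \<subseteq> Omega k q" and "i < k"
    and "\<And>x. x \<in> A \<Longrightarrow> f (delete_coord i x) = x ! i"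
  shows "saturated i A"
  unfolding saturated_def
proof (rule inj_onI)
  fix x y
  assume xy: "x \<in> A" "y \<in> A" "delete_coord i x = delete_coord i y"
  then have "length x = k" "length y = k"
    using assms(1) by (auto simp: Omega_def tuples_def)
  moreover have "x ! i = y ! i"
    using assms(3)[OF xy(1)] assms(3)[OF xy(2)] xy(3) by simp
  ultimately show "x = y"
    using delete_coord_nth_inject[of x y i] xy(3) assms(2) by simp
qed

lemma coverable_subset:
  assumes "coverable k P" and "R \<subseteq> P"
  shows "coverable k R"
proof -
  obtain Q where Q: "P = (\<Union>i<k. Q i)" "disjoint_family_on Q {..<k}" "\<forall>i<k. saturated i (Q i)"
    using assms(1) by (auto simp: coverable_def)
  have "R = (\<Union>i<k. Q i \<inter> R)"
    using Q(1) assms(2) by auto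
  moreover have "disjoint_family_on (\<lambda>i. Q i \<inter> R) {..<k}"
    using Q(2) by (auto simp: disjoint_family_on_def)
  moreover have "\<forall>i<k. saturated i (Q i \<inter> R)"
    using Q(3) by (auto simp: saturated_def intro: inj_on_subset)
  ultimately show ?thesis
    unfolding coverable_def by (intro exI[of _ "\<lambda>i. Q i \<inter> R"]) simp
qed

text \<open>Sorting the tuples by a spine that guesses them correctly yields the partition; a part
  on which spine \<open>i\<close> is always right is \<open>i\<close>-saturated.\<close>

lemma coverable_if_guessed:
  assumes "P \<subseteq> Omega k q" and guess: "\<And>x. x \<in> P \<Longrightarrow> \<exists>i<k. f i (delete_coord i x) = x ! i"
  shows "coverable k P"
proof -
  \<comment> \<open>Several spines may be right on the same tuple; choosing one of them makes the
    parts disjoint.\<close>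
  define c where "c x = (SOME i. i < k \<and> f i (delete_coord i x) = x ! i)" for x
  have c: "c x < k \<and> f (c x) (delete_coord (c x) x) = x ! c x" if "x \<in> P" for x
    unfolding c_def by (rule someI_ex) (use guess[OF that] in blast)
  define Q where "Q i = {x \<in> P. c x = i}" for i
  have "P = (\<Union>i<k. Q i)"
    using c by (auto simp: Q_def)
  moreover have "disjoint_family_on Q {..<k}"
    by (auto simp: Q_def disjoint_family_on_def)
  moreover have "saturated i (Q i)" if "i < k" for i
    by (rule saturatedI[of _ k q _ "f i"]) (use assms(1) c that in \<open>auto simp: Q_def\<close>)
  ultimately show ?thesis
    unfolding coverable_def by blast
qed

text \<open>On its saturated part, a spine recovers the whole tuple from its view and reads off its
  own color. The bound \<open>f i y < q\<close> covers every \<open>y\<close>, since a spine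
  function must return a color on all views, including those that do not come from
  \<open>P\<close>.\<close>

lemma coverable_imp_guessed:
  assumes "coverable k P" and "P \<subseteq> Omega k q" and "q > 0"
  shows "\<exists>f. (\<forall>i<k. \<forall>y. f i y < q) \<and> (\<forall>x\<in>P. \<exists>i<k. f i (delete_coord i x) = x ! i)"
proof -
  obtain Q where Q: "P = (\<Union>i<k. Q i)" "\<forall>i<k. saturated i (Q i)"
    using assms(1) by (auto simp: coverable_def)
  \<comment> \<open>Away from the views of \<open>Q i\<close> any color would do; 0 is one because
    \<open>q > 0\<close>.\<close>
  define f where "f i y = (if y \<in> delete_coord i ` Q i
    then the_inv_into (Q i) (delete_coord i) y ! i else 0)" for i y
  have f: "f i (delete_coord i x) = x ! i" if "i < k" "x \<in> Q i" for i x
    using that Q(2) by (simp add: f_def saturated_def the_inv_into_f_f)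
  have "f i y < q" if "i < k" for i y
  proof (cases "y \<in> delete_coord i ` Q i")
    case True
    then obtain x where x: "x \<in> Q i" "y = delete_coord i x"
      by blast
    then have "x \<in> Omega k q"
      using Q(1) assms(2) that by blast
    then have "x ! i < q"
      using that nth_tuples_less[of x k q i] by (simp add: Omega_def)
    then show ?thesis
      using f x that by simp
  next
    case False
    then show ?thesis
      using assms(3) by (simp add: f_def)
  qed
  then show ?thesis
    using Q(1) f by (intro exI[of _ f]) blast
qed

lemma winning_iff:
  "winning k n q g h \<longleftrightarrow>
     (\<forall>z\<in>tuples n q. \<forall>x\<in>missed k n q g z. \<exists>i<k. h i (delete_coord i x, z) = x ! i)"
  unfolding winning_def proper_colorings_def missed_def by blast

text \<open>Every spine sees all of \<open>z\<close>, so a completion amounts to an independent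
  choice of guesses for each \<open>z\<close>.\<close>

lemma completable_iff_missed_coverable:
  assumes "q > 0"
  shows "(\<exists>h. spine_functions k n q h \<and> winning k n q g h) \<longleftrightarrow>
         (\<forall>z\<in>tuples n q. coverable k (missed k n q g z))"
proof
  assume "\<exists>h. spine_functions k n q h \<and> winning k n q g h"
  then obtain h where h: "winning k n q g h"
    by blast
  show "\<forall>z\<in>tuples n q. coverable k (missed k n q g z)"
  proof
    fix z
    assume "z \<in> tuples n q"
    then show "coverable k (missed k n q g z)"
      using h coverable_if_guessed[of "missed k n q g z" k q "\<lambda>i y. h i (y, z)"]
      by (auto simp: winning_iff missed_def)
  qed
next
  assume cov: "\<forall>z\<in>tuples n q. coverable k (missed k n q g z)"
  have "\<forall>z\<in>tuples n q. \<exists>f. (\<forall>i<k. \<forall>y. f i y < q) \<and>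
      (\<forall>x\<in>missed k n q g z. \<exists>i<k. f i (delete_coord i x) = x ! i)"
  proof
    fix z
    assume "z \<in> tuples n q"
    then show "\<exists>f. (\<forall>i<k. \<forall>y. f i y < q) \<and>
        (\<forall>x\<in>missed k n q g z. \<exists>i<k. f i (delete_coord i x) = x ! i)"
      using cov assms by (intro coverable_imp_guessed[of k _ q]) (auto simp: missed_def)
  qed
  then obtain F where F: "\<forall>z\<in>tuples n q. (\<forall>i<k. \<forall>y. F z i y < q) \<and>
      (\<forall>x\<in>missed k n q g z. \<exists>i<k. F z i (delete_coord i x) = x ! i)"
    by metis
  \<comment> \<open>The guesses for the separate page colorings are glued: a spine reads
    \<open>z\<close> from its view and then plays \<open>F z\<close>.\<close>
  define h where "h i v = F (snd v) i (fst v)" for i v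
  have "spine_functions k n q h"
    using F by (auto simp: spine_functions_def h_def)
  moreover have "winning k n q g h"
    using F by (simp add: winning_iff h_def)
  ultimately show "\<exists>h. spine_functions k n q h \<and> winning k n q g h"
    by blast
qed

text \<open>The color \<open>z ! j\<close> itself is the one that page \<open>j\<close> fails to
  guard.\<close>

lemma not_pages_guard_missed:
  assumes "z \<in> tuples n q"
  shows "\<not> pages_guard n q g (missed k n q g z)"
proof -
  have "z ! j \<in> {..<q} - supp (missed k n q g z)" "z ! j \<notin> g j ` missed k n q g z" if "j < n" for j
    using that nth_tuples_less[OF assms] by (auto simp: supp_def missed_def)
  then show ?thesis
    unfolding pages_guard_def page_guards_def by blast
qed

text \<open>Each page leaves some color outside \<open>supp P\<close> unguessed on \<open>P\<close>.
  Giving every page such a color produces the required \<open>z\<close>.\<close>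

lemma subset_missed_if_not_pages_guard:
  assumes "P \<subseteq> Omega k q" and "\<not> pages_guard n q g P"
  obtains z where "z \<in> tuples n q" and "P \<subseteq> missed k n q g z"
proof -
  have "\<forall>j. j < n \<longrightarrow> (\<exists>c. c < q \<and> c \<notin> supp P \<and> c \<notin> g j ` P)"
    using assms(2) by (auto simp: pages_guard_def page_guards_def)
  then obtain c where c: "\<And>j. j < n \<Longrightarrow> c j < q \<and> c j \<notin> supp P \<and> c j \<notin> g j ` P"
    by metis
  show thesis
  proof
    show "map c [0..<n] \<in> tuples n q"
      using c by (auto simp: tuples_def)
    show "P \<subseteq> missed k n q g (map c [0..<n])"
    proof
      fix x
      assume x: "x \<in> P"
      have "map c [0..<n] ! j \<notin> set x \<and> g j x \<noteq> map c [0..<n] ! j" if "j < n" for j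
      proof -
        have "c j \<notin> set x" "c j \<noteq> g j x"
          using c[OF that] x by (auto simp: supp_def)
        then show ?thesis
          using that by simp
      qed
      then show "x \<in> missed k n q g (map c [0..<n])"
        using x assms(1) by (auto simp: missed_def)
    qed
  qed
qed

theorem theorem3p6:
  fixes k n q :: nat
    and g :: "nat \<Rightarrow> nat list \<Rightarrow> nat"
  assumes "k > 0" and "n > 0" and "q > 0"
    and "page_functions k n q g"
  shows "(\<exists>h. spine_functions k n q h \<and> winning k n q g h) \<longleftrightarrow>
         (\<forall>P. P \<subseteq> Omega k q \<longrightarrow> \<not> coverable k P \<longrightarrow> pages_guard n q g P)"
  unfolding completable_iff_missed_coverable[OF \<open>q > 0\<close>]
proof
  assume "\<forall>z\<in>tuples n q. coverable k (missed k n q g z)"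
  then show "\<forall>P. P \<subseteq> Omega k q \<longrightarrow> \<not> coverable k P \<longrightarrow> pages_guard n q g P"
    \<comment> \<open>By contraposition: an unguarded \<open>P\<close> lies in some missed set, and
      coverability passes down to \<open>P\<close>.\<close>
    by (metis subset_missed_if_not_pages_guard coverable_subset)
next
  assume guard: "\<forall>P. P \<subseteq> Omega k q \<longrightarrow> \<not> coverable k P \<longrightarrow> pages_guard n q g P"
  show "\<forall>z\<in>tuples n q. coverable k (missed k n q g z)"
  proof
    fix z
    assume "z \<in> tuples n q"
    then have "\<not> pages_guard n q g (missed k n q g z)"
      by (rule not_pages_guard_missed)
    moreover have "missed k n q g z \<subseteq> Omega k q"
      by (auto simp: missed_def)
    ultimately show "coverable k (missed k n q g z)"
      using guard by blast
  qed
qed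

end
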